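(* Let $X=\mathbb{R}^J$, let $f\in\Gamma_0(X)$ be a convex function of Legendre type satisfying (A1)--(A4) listed in the context, and let $U=\operatorname{int}\operatorname{dom} f$. Let $\theta\in\Gamma_0(X)$ be such that $U\cap\operatorname{dom}\theta\neq\varnothing$, let $\gamma\in\,]0,+\infty[$, and let $x,y\in U$. (i) Suppose that for every $v\in U$ the function $\theta(\cdot)+\frac1\gamma D_f(\cdot,v)$ is coercive. Then the following are equivalent: (a) $y\in\operatorname{argmin}\theta$; (b) $y\in\operatorname{Fix}\overleftarrow{P}_{\gamma\theta}$; (c) $y\in\operatorname{argmin}\overleftarrow{\operatorname{env}}_\theta^{\gamma}$; (d) $\theta(\overleftarrow{P}_{\gamma\theta}(y))=\theta(y)$; (e) $\overleftarrow{\operatorname{env}}_\theta^{\gamma}(y)=\theta(y)$. Consequently, $$U\cap\operatorname{argmin}\theta=\operatorname{Fix}\overleftarrow{P}_{\gamma\theta}=\operatorname{argmin}\overleftarrow{\operatorname{env}}_\theta^{\gamma}.$$ (ii) Suppose that for every $u\in U$ the function $\theta(\cdot)+\frac1\gamma D_f(u,\cdot)$ is coercive. Then the following are equivalent: (a) $x\in\operatorname{argmin}\theta$; (b) $x\in\operatorname{Fix}\overrightarrow{P}_{\gamma\theta}$; (c) $x\in\operatorname{argmin}\overrightarrow{\operatorname{env}}_\theta^{\gamma}$; (d) $\theta(\overrightarrow{P}_{\gamma\theta}(x))=\theta(x)$; (e) $\overrightarrow{\operatorname{env}}_\theta^{\gamma}(x)=\theta(x)$. Consequently, $$U\cap\o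peratorname{argmin}\theta=\operatorname{Fix}\overrightarrow{P}_{\gamma\theta}=U\cap\operatorname{argmin}\overrightarrow{\operatorname{env}}_\theta^{\gamma}.$$
   Context: $X=\mathbb{R}^J$ carries the standard inner product $\langle\cdot,\cdot\rangle$ and Euclidean norm. $\Gamma_0(X)$ is the set of proper lower semicontinuous convex functions $X\to\,]-\infty,+\infty]$; $\operatorname{dom} g=\{x: g(x)<+\infty\}$; $\operatorname{argmin}$ is taken over $X$; $\operatorname{Fix}T$ is the set of fixed points of $T$. A function $g$ is coercive if $g(x)\to+\infty$ as $\|x\|\to+\infty$. $f$ of Legendre type means essentially smooth and essentially strictly convex in the sense of Rockafellar; $U=\operatorname{int}\operatorname{dom}f\ne\varnothing$. The Bregman distance is $D_f(x,y)=f(x)-f(y)-\langle\nabla f(y),x-y\rangle$ if $y\in U$, and $D_f(x,y)=+\infty$ otherwise. Standing assumptions: (A1) $\nabla^2 f$ exists and is continuous on $U$; (A2) $D_f$ is convex on $X\times X$; (A3) for every $x\in U$, $D_f(x,\cdot)$ is strictly convex on $U$; (A4) for every $x\in U$, $D_f(x,\cdot)$ is coercive. The left and right Bregman--Moreau envelopes are $\overleftarrow{\operatorname{env}}_\theta^{\gamma}(y)=\inf_{x\in X}\big(\theta(x)+\frac1\gamma D_f(x,y)\big)$ and $\overrightarrow{\operatorname{env}}_\theta^{\gamma}(x)=\inf_{y\in X}\big(\theta(y)+\frac1\gamma D_f(x,y)\big)$, functions $X\to[-\infty,+\infty]$. When $\theta(\cdot)+\frac1\gamma D_f(\cdot,v)$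 is coercive for every $v\in U$, the left proximity operator $\overleftarrow{P}_{\gamma\theta}\colon U\to U$ sends $y$ to the unique minimizer over $x\in X$ of $\gamma\theta(x)+D_f(x,y)$. When $\theta(\cdot)+\frac1\gamma D_f(u,\cdot)$ is coercive for every $u\in U$, the right proximity operator $\overrightarrow{P}_{\gamma\theta}\colon U\to U$ sends $x$ to the unique minimizer over $y\in X$ of $\gamma\theta(y)+D_f(x,y)$. (These minimizers exist, are unique and lie in $U$.) *)

theory Defs
  imports "HOL-Analysis.Analysis"
begin

section \<open>Extended-real-valued convex analysis\<close>

definition edom :: "('a \<Rightarrow> ereal) \<Rightarrow> 'a set" where
  "edom g = {x. g x < \<infinity>}"

definition proper_fun :: "('a \<Rightarrow> ereal) \<Rightarrow> bool" where
  "proper_fun g \<longleftrightarrow> (\<forall>x. g x \<noteq> - \<infinity>) \<and> edom g \<noteq> {}"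

definition lsc_fun :: "('a::topological_space \<Rightarrow> ereal) \<Rightarrow> bool" where
  "lsc_fun g \<longleftrightarrow> (\<forall>x. g x \<le> Liminf (at x) g)"

text \<open>Convexity is convexity of the epigraph, which avoids \<open>\<infinity> - \<infinity>\<close>; the library's
  \<open>convex_on\<close> covers real-valued functions only.\<close>

definition convex_fun :: "('a::real_vector \<Rightarrow> ereal) \<Rightarrow> bool" where
  "convex_fun g \<longleftrightarrow> convex {(x, r::real). g x \<le> ereal r}"

definition strictly_convex_fun_on :: "'a::real_vector set \<Rightarrow> ('a \<Rightarrow> ereal) \<Rightarrow> bool" where
  "strictly_convex_fun_on C g \<longleftrightarrow>
     (\<forall>x\<in>C. \<forall>y\<in>C. \<forall>t::real. x \<noteq> y \<and> 0 < t \<and> t < 1 \<longrightarrow>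
        g ((1 - t) *\<^sub>R x + t *\<^sub>R y) < ereal (1 - t) * g x + ereal t * g y)"

definition Gamma0 :: "('a::real_normed_vector \<Rightarrow> ereal) set" where
  "Gamma0 = {g. proper_fun g \<and> lsc_fun g \<and> convex_fun g}"

definition coercive :: "('a::real_normed_vector \<Rightarrow> ereal) \<Rightarrow> bool" where
  "coercive g \<longleftrightarrow> (g \<longlongrightarrow> \<infinity>) at_infinity"

definition argmin :: "('a \<Rightarrow> ereal) \<Rightarrow> 'a set" where
  "argmin g = {x. is_arg_min g (\<lambda>_. True) x}"

text \<open>Fixed points of an operator \<open>T\<close> with domain \<open>U\<close>; the values of \<open>T\<close> off \<open>U\<close> are
  irrelevant.\<close>

definition Fix_on :: "'a set \<Rightarrow> ('a \<Rightarrow> 'a) \<Rightarrow> 'a set" where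
  "Fix_on U T = {x \<in> U. T x = x}"


section \<open>Functions of Legendre type\<close>

text \<open>Meaningful at points of \<open>interior (edom f)\<close> where \<open>f\<close> is differentiable; there a proper
  \<open>f\<close> is finite on a neighbourhood, so \<open>real_of_ereal\<close> loses nothing.\<close>

definition grad :: "('a::real_inner \<Rightarrow> ereal) \<Rightarrow> 'a \<Rightarrow> 'a" where
  "grad f x = (THE d. GDERIV (\<lambda>z. real_of_ereal (f z)) x :> d)"

definition subdifferential :: "('a::real_inner \<Rightarrow> ereal) \<Rightarrow> 'a \<Rightarrow> 'a set" where
  "subdifferential f x = {v. \<forall>z. f x + ereal (v \<bullet> (z - x)) \<le> f z}"

definition essentially_smooth :: "('a::euclidean_space \<Rightarrow> ereal) \<Rightarrow> bool" where
  "essentially_smooth f \<longleftrightarrow>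
     interior (edom f) \<noteq> {} \<and>
     (\<forall>x\<in>interior (edom f). (\<lambda>z. real_of_ereal (f z)) differentiable (at x)) \<and>
     (\<forall>s z. (\<forall>n::nat. s n \<in> interior (edom f)) \<and> s \<longlonglongrightarrow> z \<and> z \<in> frontier (interior (edom f)) \<longrightarrow>
        filterlim (\<lambda>n. norm (grad f (s n))) at_top sequentially)"

definition essentially_strictly_convex :: "('a::euclidean_space \<Rightarrow> ereal) \<Rightarrow> bool" where
  "essentially_strictly_convex f \<longleftrightarrow>
     (\<forall>C. convex C \<and> C \<subseteq> {x. subdifferential f x \<noteq> {}} \<longrightarrow> strictly_convex_fun_on C f)"

definition legendre_type :: "('a::euclidean_space \<Rightarrow> ereal) \<Rightarrow> bool" where
  "legendre_type f \<longleftrightarrow> essentially_smooth f \<and> essentially_strictly_convex f"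

text \<open>The Hessian is taken as the derivative of the gradient map, in the operator space
  \<open>'a \<Rightarrow>\<^sub>L 'a\<close>.\<close>

definition continuous_hessian_on :: "'a::euclidean_space set \<Rightarrow> ('a \<Rightarrow> ereal) \<Rightarrow> bool" where
  "continuous_hessian_on U f \<longleftrightarrow>
     (\<exists>H :: 'a \<Rightarrow> 'a \<Rightarrow>\<^sub>L 'a.
        (\<forall>x\<in>U. (grad f has_derivative blinfun_apply (H x)) (at x)) \<and> continuous_on U H)"


section \<open>Bregman distances, envelopes and proximity operators\<close>

definition bregman :: "('a::euclidean_space \<Rightarrow> ereal) \<Rightarrow> 'a \<Rightarrow> 'a \<Rightarrow> ereal" where
  "bregman f x y =
     (if y \<in> interior (edom f) then f x - f y - ereal (grad f y \<bullet> (x - y)) else \<infinity>)"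

definition left_env ::
    "('a::euclidean_space \<Rightarrow> ereal) \<Rightarrow> ('a \<Rightarrow> ereal) \<Rightarrow> real \<Rightarrow> 'a \<Rightarrow> ereal" where
  "left_env f \<theta> \<gamma> y = (INF x. \<theta> x + ereal (1 / \<gamma>) * bregman f x y)"

definition right_env ::
    "('a::euclidean_space \<Rightarrow> ereal) \<Rightarrow> ('a \<Rightarrow> ereal) \<Rightarrow> real \<Rightarrow> 'a \<Rightarrow> ereal" where
  "right_env f \<theta> \<gamma> x = (INF y. \<theta> y + ereal (1 / \<gamma>) * bregman f x y)"

text \<open>The proximity operators are operators on \<open>interior (edom f)\<close>, where under the coercivity
  assumptions the minimizers exist, are unique and belong to that set.\<close>

definition left_prox ::
    "('a::euclidean_space \<Rightarrow> ereal) \<Rightarrow> ('a \<Rightarrow> ereal) \<Rightarrow> real \<Rightarrow> 'a \<Rightarrow> 'a" where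
  "left_prox f \<theta> \<gamma> y = (THE x. x \<in> argmin (\<lambda>x. ereal \<gamma> * \<theta> x + bregman f x y))"

definition right_prox ::
    "('a::euclidean_space \<Rightarrow> ereal) \<Rightarrow> ('a \<Rightarrow> ereal) \<Rightarrow> real \<Rightarrow> 'a \<Rightarrow> 'a" where
  "right_prox f \<theta> \<gamma> x = (THE y. y \<in> argmin (\<lambda>y. ereal \<gamma> * \<theta> y + bregman f x y))"

end

theory Submission
  imports Defs
begin

text \<open>Both envelopes have the form \<open>inf b. \<theta> b + d a b / \<gamma>\<close> with \<open>d \<ge> 0\<close> vanishing exactly on the
  diagonal, and the equivalences use nothing else about \<open>d\<close> beyond three facts: for \<open>a \<in> U\<close> the
  infimum is attained, it is attained at exactly one point, which lies in \<open>U\<close>, and \<open>d a b\<close> is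
  \<open>o(norm (b - a))\<close> as \<open>b \<longlonglongrightarrow> a\<close>, so that a minimizer of the perturbed function sitting
  at \<open>a\<close> already minimizes the convex function \<open>\<theta>\<close>. For the Bregman distance the last fact
  follows from \<open>D(x, y) + D(y, x) = (\<nabla>f x - \<nabla>f y) \<bullet> (x - y)\<close> and continuity of
  \<open>\<nabla>f\<close>. The behaviour at the boundary of \<open>U\<close> is governed by the growth estimate
  \<open>D(x, v) \<ge> \<epsilon> * norm (\<nabla>f v) - C\<close> for fixed \<open>x \<in> U\<close>: together with essential smoothness it
  makes \<open>D(x, \<cdot>)\<close> lower semicontinuous and keeps the minimizers of the left problem inside \<open>U\<close>.\<close>

section \<open>Minimizers of extended-real-valued functions\<close>

lemma in_argmin_iff: "x \<in> argmin g \<longleftrightarrow> (\<forall>z. g x \<le> g z)"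
  by (auto simp: argmin_def is_arg_min_linorder)

lemma in_argmin_cmult_iff:
  fixes g :: "'a \<Rightarrow> ereal"
  assumes "0 < c"
  shows "x \<in> argmin (\<lambda>z. ereal c * g z) \<longleftrightarrow> x \<in> argmin g"
  using assms ereal_mult_le_mult_iff[of "ereal c"] by (simp add: in_argmin_iff)

text \<open>The operators put \<open>\<gamma>\<close> on \<open>\<theta>\<close>, the envelopes put
  \<open>1 / \<gamma>\<close> on the distance. The two objectives differ by the positive factor
  \<open>\<gamma>\<close>, so one minimization problem serves both.\<close>

lemma argmin_scale:
  fixes \<theta> d :: "'a \<Rightarrow> ereal"
  assumes "0 < \<gamma>"
  shows "argmin (\<lambda>x. ereal \<gamma> * \<theta> x + d x) = argmin (\<lambda>x. \<theta> x + ereal (1 / \<gamma>) * d x)"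
proof -
  have "ereal \<gamma> * \<theta> x + d x = ereal \<gamma> * (\<theta> x + ereal (1 / \<gamma>) * d x)" for x
    using assms by (simp add: ereal_pos_distrib mult.assoc[symmetric] one_ereal_def[symmetric])
  then show ?thesis
    by (simp add: set_eq_iff in_argmin_cmult_iff[OF assms])
qed

text \<open>One point of finite value makes the minimum finite, and since neither summand is
  \<open>- \<infinity>\<close>, a finite sum has finite summands. Finiteness of
  \<open>\<phi> p\<close> later places right minimizers in \<open>U\<close>.\<close>

lemma argmin_perturbed_finite:
  fixes \<theta> :: "'a \<Rightarrow> ereal"
  assumes \<theta>: "\<And>x. \<theta> x \<noteq> - \<infinity>" and \<phi>: "\<And>x. 0 \<le> \<phi> x" and c: "0 < c"
    and u: "\<theta> u + ereal c * \<phi> u < \<infinity>"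
    and p: "p \<in> argmin (\<lambda>x. \<theta> x + ereal c * \<phi> x)"
  shows "\<theta> p + ereal c * \<phi> p < \<infinity>" "\<theta> p < \<infinity>" "\<phi> p < \<infinity>"
proof -
  show *: "\<theta> p + ereal c * \<phi> p < \<infinity>"
    using p u by (auto simp: in_argmin_iff intro: le_less_trans)
  show "\<theta> p < \<infinity>" "\<phi> p < \<infinity>"
    using * \<theta>[of p] c by (cases "\<theta> p"; cases "\<phi> p"; auto)+
qed

section \<open>Lower semicontinuity and attainment of minima\<close>

lemma lsc_fun_iff:
  "lsc_fun g \<longleftrightarrow> (\<forall>x c. c < g x \<longrightarrow> (\<forall>\<^sub>F z in at x. c < g z))"
  by (simp add: lsc_fun_def le_Liminf_iff)

lemma lsc_fun_eventually_nhds: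
  assumes "lsc_fun g" "c < g x"
  shows "\<forall>\<^sub>F z in nhds x. c < g z"
  using assms by (simp add: lsc_fun_iff eventually_nhds_conv_at)

lemma lsc_fun_add:
  fixes g h :: "'a::topological_space \<Rightarrow> ereal"
  assumes g: "lsc_fun g" "\<And>x. g x \<noteq> - \<infinity>" and h: "lsc_fun h" "\<And>x. h x \<noteq> - \<infinity>"
  shows "lsc_fun (\<lambda>x. g x + h x)"
  unfolding lsc_fun_iff
proof (intro allI impI)
  fix x and c :: ereal
  assume c: "c < g x + h x"
  show "\<forall>\<^sub>F z in at x. c < g z + h z"
  proof (cases c)
    case MInf
    then show ?thesis
      using g(2) h(2) by simp
  next
    case PInf
    with c show ?thesis by simp
  next
    case (real r)
    \<comment> \<open>The real level is split between the summands: each gives up half of the gap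
      when both are finite, otherwise an infinite summand absorbs the remainder.\<close>
    have "\<exists>a b. c \<le> ereal a + ereal b \<and> ereal a < g x \<and> ereal b < h x"
    proof (cases "g x"; cases "h x")
      fix p q assume "g x = ereal p" "h x = ereal q"
      then show ?thesis using c real
        by (intro exI[of _ "p - (p + q - r) / 2"] exI[of _ "q - (p + q - r) / 2"])
          (auto simp: field_simps)
    next
      fix p assume "g x = ereal p" "h x = \<infinity>"
      then show ?thesis using real
        by (intro exI[of _ "p - 1"] exI[of _ "r - p + 1"]) auto
    next
      fix q assume "g x = \<infinity>" "h x = ereal q"
      then show ?thesis using real
        by (intro exI[of _ "r - q + 1"] exI[of _ "q - 1"]) auto
    next
      assume "g x = \<infinity>" "h x = \<infinity>"
      then show ?thesis using real by (intro exI[of _ r] exI[of _ 0]) auto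
    qed (use g(2) h(2) in auto)
    then obtain a b where ab: "c \<le> ereal a + ereal b" "ereal a < g x" "ereal b < h x"
      by blast
    have "\<forall>\<^sub>F z in at x. ereal a < g z" "\<forall>\<^sub>F z in at x. ereal b < h z"
      using g(1) h(1) ab by (auto simp: lsc_fun_iff)
    then show ?thesis
      by eventually_elim (use ab(1) ereal_add_strict_mono2 in \<open>blast intro: le_less_trans\<close>)
  qed
qed

lemma lsc_fun_cmult:
  fixes g :: "'a::topological_space \<Rightarrow> ereal"
  assumes "lsc_fun g" "0 < c"
  shows "lsc_fun (\<lambda>x. ereal c * g x)"
proof -
  have "k < ereal c * z \<longleftrightarrow> ereal (1 / c) * k < z" for k z
    using \<open>0 < c\<close> by (cases k; cases z) (auto simp: field_simps)
  then show ?thesis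
    using assms(1) by (simp add: lsc_fun_iff)
qed

lemma lsc_fun_ereal:
  fixes h :: "'a::topological_space \<Rightarrow> real"
  assumes "continuous_on UNIV h"
  shows "lsc_fun (\<lambda>x. ereal (h x))"
  unfolding lsc_fun_iff
proof (intro allI impI)
  fix x and c :: ereal
  assume "c < ereal (h x)"
  moreover have "((\<lambda>x. ereal (h x)) \<longlongrightarrow> ereal (h x)) (at x)"
    using assms by (intro tendsto_intros) (simp add: continuous_on_def)
  ultimately show "\<forall>\<^sub>F z in at x. c < ereal (h z)"
    by (rule order_tendstoD(1)[rotated])
qed

text \<open>Coercivity confines the search to a closed ball. There a minimizing sequence has a
  convergent subsequence, and lower semicontinuity bounds the value at its limit by the
  infimum.\<close>

lemma lsc_coercive_argmin_nonempty:
  fixes g :: "'a::euclidean_space \<Rightarrow> ereal"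
  assumes lsc: "lsc_fun g" and coe: "coercive g" and fin: "g z < \<infinity>"
  shows "\<exists>x. x \<in> argmin g"
proof -
  have "\<forall>\<^sub>F x in at_infinity. g z < g x"
    using coe fin unfolding coercive_def by (rule order_tendstoD(1))
  then obtain R where R: "\<And>x. R \<le> norm x \<Longrightarrow> g z < g x"
    by (auto simp: eventually_at_infinity)
  then have zR: "z \<in> cball 0 R"
    by (meson less_irrefl linear mem_cball_0)
  define m where "m = Inf (g ` cball 0 R)"
  obtain u where u: "\<And>n. u n \<in> g ` cball 0 R" "u \<longlonglongrightarrow> m"
    using Inf_as_limit[of "g ` cball 0 R"] zR unfolding m_def by blast
  then have "\<forall>n. \<exists>s. s \<in> cball 0 R \<and> u n = g s"
    by blast
  then obtain s where s: "\<And>n. s n \<in> cball 0 R" "\<And>n. u n = g (s n)"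
    by metis
  obtain l r where l: "l \<in> cball 0 R" "strict_mono r" "(s \<circ> r) \<longlonglongrightarrow> l"
    using compact_cball[of "0::'a" R] s(1) unfolding compact_def by metis
  \<comment> \<open>A level \<open>c\<close> strictly between \<open>m\<close> and
    \<open>g l\<close> would eventually lie below the values on the subsequence, by lower
    semicontinuity, and above them, because they tend to \<open>m\<close>.\<close>
  have lm: "g l \<le> m"
  proof (rule ccontr)
    assume "\<not> g l \<le> m"
    then obtain c where c: "m < c" "c < g l"
      using dense by (meson not_le)
    have "\<forall>\<^sub>F n in sequentially. c < g ((s \<circ> r) n)"
      using lsc_fun_eventually_nhds[OF lsc c(2)] l(3)
      by (rule eventually_compose_filterlim)
    moreover have "(u \<circ> r) \<longlonglongrightarrow> m"
      using u(2) l(2) by (rule LIMSEQ_subseq_LIMSEQ)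
    then have "\<forall>\<^sub>F n in sequentially. (u \<circ> r) n < c"
      using c(1) by (rule order_tendstoD(2))
    ultimately have "\<forall>\<^sub>F n in sequentially. n \<noteq> n"
      by eventually_elim (simp add: s(2))
    then show False by simp
  qed
  have "g l \<le> g x" for x
  proof (cases "norm x \<le> R")
    case True
    then have "m \<le> g x" by (auto simp: m_def intro: Inf_lower)
    with lm show ?thesis by (rule order_trans)
  next
    case False
    have "m \<le> g z"
      using zR by (auto simp: m_def intro: Inf_lower)
    with lm have "g l \<le> g z" by (rule order_trans)
    with R[of x] False show ?thesis by simp
  qed
  then show ?thesis
    by (auto simp: in_argmin_iff)
qed

section \<open>Convexity: segments, uniqueness of minimizers, small perturbations\<close>

lemma convex_funD:
  assumes "convex_fun g" "g x \<le> ereal a" "g y \<le> ereal b" "0 \<le> t" "t \<le> 1"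
  shows "g (x + t *\<^sub>R (y - x)) \<le> ereal (a + t * (b - a))"
proof -
  have "(1 - t) *\<^sub>R (x, a) + t *\<^sub>R (y, b) \<in> {(x, r). g x \<le> ereal r}"
    using assms unfolding convex_fun_def by (intro convexD) auto
  then show ?thesis
    by (simp add: algebra_simps)
qed

lemma convex_edom:
  assumes "convex_fun g"
  shows "convex (edom g)"
proof (rule convexI)
  fix x y and u v :: real
  assume xy: "x \<in> edom g" "y \<in> edom g" and uv: "0 \<le> u" "0 \<le> v" "u + v = 1"
  obtain a b where "g x \<le> ereal a" "g y \<le> ereal b"
    using xy by (auto simp: edom_def less_PInf_Ex_of_nat) (meson less_imp_le)
  from convex_funD[OF assms this, of v] uv
  have "g (x + v *\<^sub>R (y - x)) < \<infinity>"
    by (auto intro: le_less_trans)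
  moreover have "x + v *\<^sub>R (y - x) = u *\<^sub>R x + v *\<^sub>R y"
    using uv(3) by (simp add: algebra_simps flip: scaleR_add_left)
  ultimately show "u *\<^sub>R x + v *\<^sub>R y \<in> edom g"
    by (simp add: edom_def)
qed

text \<open>At the midpoint of two distinct minimizers the convex part is at most the average and
  the strictly convex part is below it. The assumption \<open>fin\<close> preserves the strict
  inequality, which adding \<open>\<infinity>\<close> would erase.\<close>

lemma argmin_add_strictly_convex_unique:
  fixes \<theta> \<phi> :: "'a::real_vector \<Rightarrow> ereal"
  assumes \<theta>: "convex_fun \<theta>" "\<And>x. \<theta> x \<noteq> - \<infinity>"
    and \<phi>: "strictly_convex_fun_on C \<phi>" "\<And>x. \<phi> x \<noteq> - \<infinity>"
    and c: "0 < c"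
    and p: "p \<in> C" "p \<in> argmin (\<lambda>x. \<theta> x + ereal c * \<phi> x)"
    and q: "q \<in> C" "q \<in> argmin (\<lambda>x. \<theta> x + ereal c * \<phi> x)"
    and fin: "\<theta> p + ereal c * \<phi> p < \<infinity>"
  shows "p = q"
proof (rule ccontr)
  assume "p \<noteq> q"
  have eq: "\<theta> p + ereal c * \<phi> p = \<theta> q + ereal c * \<phi> q"
    using p(2) q(2) by (auto simp: in_argmin_iff intro: antisym)
  obtain a1 a2 where a: "\<theta> p = ereal a1" "\<phi> p = ereal a2"
    using fin \<theta>(2)[of p] \<phi>(2)[of p] c by (cases "\<theta> p"; cases "\<phi> p") auto
  obtain b1 b2 where b: "\<theta> q = ereal b1" "\<phi> q = ereal b2"
    using fin eq \<theta>(2)[of q] \<phi>(2)[of q] c by (cases "\<theta> q"; cases "\<phi> q") auto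
  define m where "m = p + (1/2) *\<^sub>R (q - p)"
  have "m = (1 - 1/2) *\<^sub>R p + (1/2) *\<^sub>R q"
    by (simp add: m_def algebra_simps flip: scaleR_add_left)
  moreover have "\<phi> ((1 - 1/2) *\<^sub>R p + (1/2) *\<^sub>R q) < ereal (1 - 1/2) * \<phi> p + ereal (1/2) * \<phi> q"
    using p(1) q(1) \<open>p \<noteq> q\<close>
    by (intro \<phi>(1)[unfolded strictly_convex_fun_on_def, rule_format]) auto
  ultimately have m2: "\<phi> m < ereal ((a2 + b2) / 2)"
    using a b by (simp add: add_divide_distrib)
  have m1: "\<theta> m \<le> ereal (a1 + (1/2) * (b1 - a1))"
    unfolding m_def using a b by (intro convex_funD[OF \<theta>(1)]) auto
  have le: "\<theta> p + ereal c * \<phi> p \<le> \<theta> m + ereal c * \<phi> m"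
    using p(2) by (auto simp: in_argmin_iff)
  obtain m1' m2' where m: "\<theta> m = ereal m1'" "\<phi> m = ereal m2'"
    using m1 m2 \<theta>(2)[of m] \<phi>(2)[of m] by (cases "\<theta> m"; cases "\<phi> m") auto
  have "c * m2' < c * ((a2 + b2) / 2)"
    using m2 m c by auto
  moreover have "c * ((a2 + b2) / 2) = (c * a2 + c * b2) / 2"
    by (simp add: algebra_simps)
  moreover have "b1 + c * b2 \<le> m1' + c * m2'" "a1 + c * a2 = b1 + c * b2"
    "m1' \<le> a1 + (1/2) * (b1 - a1)"
    using le eq a b m m1 by simp_all
  ultimately show False
    by argo
qed

text \<open>If \<open>\<theta> z < \<theta> a\<close>, moving from \<open>a\<close> by a fraction
  \<open>t\<close> towards \<open>z\<close> lowers \<open>\<theta>\<close> at least linearly in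
  \<open>t\<close> by convexity, while the perturbation costs only \<open>o(t)\<close>. For small
  \<open>t\<close> the sum would fall below its minimum.\<close>

lemma argmin_of_argmin_perturbed:
  fixes \<theta> \<phi> :: "'a::real_normed_vector \<Rightarrow> ereal" and k :: "'a \<Rightarrow> real"
  assumes \<theta>: "convex_fun \<theta>" "\<And>x. \<theta> x \<noteq> - \<infinity>"
    and c: "0 < c"
    and a: "a \<in> argmin (\<lambda>x. \<theta> x + ereal c * \<phi> x)" "\<theta> a < \<infinity>" "\<phi> a = 0"
    and small: "\<forall>\<^sub>F z in at a. \<phi> z \<le> ereal (k z * norm (z - a))" "(k \<longlongrightarrow> 0) (at a)"
  shows "a \<in> argmin \<theta>"
proof (rule ccontr)
  assume "a \<notin> argmin \<theta>"
  then obtain z where z: "\<theta> z < \<theta> a"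
    by (auto simp: in_argmin_iff not_le)
  obtain s where s: "\<theta> a = ereal s"
    using a(2) \<theta>(2)[of a] by (cases "\<theta> a") auto
  obtain r where r: "\<theta> z = ereal r"
    using z s \<theta>(2)[of z] by (cases "\<theta> z") auto
  have rs: "r < s"
    using z r s by simp
  have "z \<noteq> a"
    using z by auto
  define p where "p t = a + t *\<^sub>R (z - a)" for t :: real
  \<comment> \<open>The bound in \<open>small\<close> holds on a punctured neighbourhood, so the
    path must approach \<open>a\<close> without meeting it; this uses
    \<open>z \<noteq> a\<close>.\<close>
  have "filterlim p (at a) (at_right 0)"
  proof (rule filterlim_atI)
    have "(p \<longlongrightarrow> a + 0 *\<^sub>R (z - a)) (at_right 0)"
      unfolding p_def by (intro tendsto_intros)
    then show "(p \<longlongrightarrow> a) (at_right 0)" by simp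
    show "\<forall>\<^sub>F t in at_right 0. p t \<noteq> a"
      using \<open>z \<noteq> a\<close> by (auto simp: p_def eventually_at_right_field intro!: exI[of _ 1])
  qed
  then have "\<forall>\<^sub>F t in at_right 0. \<phi> (p t) \<le> ereal (k (p t) * norm (p t - a))"
    and "((\<lambda>t. k (p t)) \<longlongrightarrow> 0) (at_right 0)"
    using small by (auto intro: eventually_compose_filterlim filterlim_compose)
  then have "((\<lambda>t. c * k (p t) * norm (z - a)) \<longlongrightarrow> c * 0 * norm (z - a)) (at_right 0)"
    by (intro tendsto_intros)
  then have "((\<lambda>t. c * k (p t) * norm (z - a)) \<longlongrightarrow> 0) (at_right 0)"
    by simp
  then have "\<forall>\<^sub>F t in at_right 0. c * k (p t) * norm (z - a) < s - r"
    using rs by (intro order_tendstoD(2)) auto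
  moreover have "\<forall>\<^sub>F t in at_right (0::real). 0 < t \<and> t < 1"
    by (auto simp: eventually_at_right_field intro!: exI[of _ 1])
  moreover note \<open>\<forall>\<^sub>F t in at_right 0. \<phi> (p t) \<le> _ t\<close>
  \<comment> \<open>The absurd \<open>t \<noteq> t\<close> records a contradiction at every small
    \<open>t\<close>; as \<open>at_right 0\<close> is not the trivial filter, it cannot hold
    eventually.\<close>
  ultimately have "\<forall>\<^sub>F t in at_right (0::real). t \<noteq> t"
  proof eventually_elim
    case (elim t)
    have 1: "\<theta> (p t) \<le> ereal (s + t * (r - s))"
      unfolding p_def using elim r s by (intro convex_funD[OF \<theta>(1)]) auto
    have "\<phi> (p t) \<le> ereal (k (p t) * (t * norm (z - a)))"
      using elim by (simp add: p_def)
    then have "ereal c * \<phi> (p t) \<le> ereal c * ereal (k (p t) * (t * norm (z - a)))"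
      using c by (intro ereal_mult_left_mono) auto
    with 1 have "\<theta> (p t) + ereal c * \<phi> (p t)
        \<le> ereal (s + t * (r - s)) + ereal c * ereal (k (p t) * (t * norm (z - a)))"
      by (rule add_mono)
    moreover have "ereal s \<le> \<theta> (p t) + ereal c * \<phi> (p t)"
      using a s by (simp add: in_argmin_iff)
    ultimately have "ereal s \<le> ereal (s + t * (r - s)) + ereal c * ereal (k (p t) * (t * norm (z - a)))"
      by (metis order_trans)
    then have "t * (s - r) \<le> t * (c * k (p t) * norm (z - a))"
      by (simp add: algebra_simps)
    with elim show "t \<noteq> t" by simp
  qed
  then show False by simp
qed

section \<open>The equivalences for an abstract distance\<close>

text \<open>On \<open>U\<close> the diagonal gives \<open>J a a = \<theta> a\<close>, and everywhere
  \<open>\<theta> b \<le> J e b\<close>. Hence the envelope lies below \<open>\<theta>\<close> on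
  \<open>U\<close> and never drops below the infimum of \<open>\<theta>\<close>. The parameter of
  the problem is the first argument of \<open>d\<close>, the variable the second.\<close>

lemma prox_env_equivalences:
  fixes \<theta> :: "'a \<Rightarrow> ereal" and d :: "'a \<Rightarrow> 'a \<Rightarrow> ereal" and c :: real and U :: "'a set"
  defines "J \<equiv> \<lambda>a b. \<theta> b + ereal c * d a b"
  defines "prox \<equiv> \<lambda>a. THE b. b \<in> argmin (J a)"
  defines "env \<equiv> \<lambda>a. INF b. J a b"
  assumes \<theta>: "\<And>x. \<theta> x \<noteq> - \<infinity>"
    and c: "0 < c"
    and nonneg: "\<And>a b. 0 \<le> d a b"
    and zero: "\<And>a b. a \<in> U \<Longrightarrow> d a b = 0 \<longleftrightarrow> a = b"
    and fin: "\<And>a. a \<in> U \<Longrightarrow> \<exists>b. J a b < \<infinity>"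
    and ex: "\<And>a. a \<in> U \<Longrightarrow> \<exists>b. b \<in> argmin (J a)"
    and uniq: "\<And>a p q. a \<in> U \<Longrightarrow> p \<in> argmin (J a) \<Longrightarrow> q \<in> argmin (J a) \<Longrightarrow> p = q"
    and mem: "\<And>a p. a \<in> U \<Longrightarrow> p \<in> argmin (J a) \<Longrightarrow> p \<in> U"
    and self: "\<And>a. a \<in> U \<Longrightarrow> a \<in> argmin (J a) \<Longrightarrow> a \<in> argmin \<theta>"
    and a: "a \<in> U"
  shows "a \<in> argmin \<theta> \<longleftrightarrow> a \<in> Fix_on U prox"
    and "a \<in> argmin \<theta> \<longleftrightarrow> a \<in> argmin env"
    and "a \<in> argmin \<theta> \<longleftrightarrow> \<theta> (prox a) = \<theta> a"
    and "a \<in> argmin \<theta> \<longleftrightarrow> env a = \<theta> a"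
proof -
  have prox: "prox b \<in> argmin (J b)" if "b \<in> U" for b
    unfolding prox_def using ex[OF that] uniq[OF that] by (metis theI)
  have prox_eq: "prox b = b \<longleftrightarrow> b \<in> argmin (J b)" if "b \<in> U" for b
    using prox[OF that] uniq[OF that] by metis
  have J_self: "J b b = \<theta> b" if "b \<in> U" for b
    using zero[OF that, of b] by (simp add: J_def)
  have \<theta>_le_J: "\<theta> b \<le> J e b" for b e
    using nonneg[of e b] c by (simp add: J_def add_increasing2)
  have env_prox: "env b = J b (prox b)" if "b \<in> U" for b
    using prox[OF that] unfolding env_def in_argmin_iff
    by (intro antisym INF_lower INF_greatest) auto
  have argmin_J: "b \<in> argmin (J b)" if "b \<in> U" "b \<in> argmin \<theta>" for b
    using that \<theta>_le_J J_self by (metis in_argmin_iff order_trans)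
  \<comment> \<open>A minimum of \<open>J a\<close> not exceeding \<open>\<theta> (prox a)\<close>
    leaves no room for a positive distance. Cancelling \<open>\<theta> (prox a)\<close> requires it
    to be finite, which \<open>fin\<close> ensures.\<close>
  have prox_fix: "prox a = a" if "J a (prox a) \<le> \<theta> (prox a)"
  proof -
    obtain b where "J a b < \<infinity>" using fin[OF a] ..
    then have "J a (prox a) < \<infinity>"
      using prox[OF a] by (auto simp: in_argmin_iff intro: le_less_trans)
    then have "d a (prox a) \<le> 0"
      using that \<theta>[of "prox a"] c unfolding J_def
      by (cases "\<theta> (prox a)"; cases "d a (prox a)") (auto simp: mult_le_0_iff)
    then show ?thesis
      using nonneg[of a "prox a"] zero[OF a] by (metis antisym)
  qed
  show Fix: "a \<in> argmin \<theta> \<longleftrightarrow> a \<in> Fix_on U prox"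
    using a argmin_J self prox_eq by (auto simp: Fix_on_def)
  have env_le: "env b \<le> \<theta> b" if "b \<in> U" for b
    using J_self[OF that] unfolding env_def by (metis INF_lower UNIV_I)
  show "a \<in> argmin \<theta> \<longleftrightarrow> a \<in> argmin env"
  proof
    assume "a \<in> argmin \<theta>"
    then have "\<theta> a \<le> env b" for b
      unfolding env_def using \<theta>_le_J by (intro INF_greatest) (metis in_argmin_iff order_trans)
    then show "a \<in> argmin env"
      using env_le[OF a] by (auto simp: in_argmin_iff intro: order_trans)
  next
    assume "a \<in> argmin env"
    then have "env a \<le> env (prox a)"
      by (simp add: in_argmin_iff)
    \<comment> \<open>The bound \<open>env_le\<close> is available only at points of
      \<open>U\<close>, hence the appeal to \<open>mem\<close>.\<close>
    also have "\<dots> \<le> \<theta> (prox a)"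
      using mem[OF a prox[OF a]] by (rule env_le)
    finally have "prox a = a"
      using env_prox[OF a] prox_fix by simp
    then show "a \<in> argmin \<theta>"
      using Fix a by (simp add: Fix_on_def)
  qed
  show "a \<in> argmin \<theta> \<longleftrightarrow> \<theta> (prox a) = \<theta> a"
  proof
    assume "\<theta> (prox a) = \<theta> a"
    then have "J a (prox a) \<le> \<theta> (prox a)"
      using prox[OF a] J_self[OF a] by (simp add: in_argmin_iff) metis
    then have "prox a = a" by (rule prox_fix)
    then show "a \<in> argmin \<theta>"
      using Fix a by (simp add: Fix_on_def)
  qed (use Fix in \<open>simp add: Fix_on_def\<close>)
  show "a \<in> argmin \<theta> \<longleftrightarrow> env a = \<theta> a"
  proof
    assume "a \<in> argmin \<theta>"
    then show "env a = \<theta> a"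
      using Fix a env_prox[OF a] J_self[OF a] by (simp add: Fix_on_def)
  next
    assume "env a = \<theta> a"
    then have "a \<in> argmin (J a)"
      using J_self[OF a] unfolding env_def in_argmin_iff by (metis INF_lower UNIV_I)
    then show "a \<in> argmin \<theta>"
      using self[OF a] by simp
  qed
qed


section \<open>Bregman distances of Legendre functions\<close>

text \<open>The derivative \<open>D\<close> is a linear functional, and
  \<open>D h = D h * 1 = h \<bullet> adjoint D 1\<close> exhibits the vector representing it.
  Uniqueness of derivatives then resolves the description in \<open>grad\<close>.\<close>

lemma grad_GDERIV:
  fixes f :: "'a::euclidean_space \<Rightarrow> ereal"
  assumes "(\<lambda>z. real_of_ereal (f z)) differentiable (at x)"
  shows "GDERIV (\<lambda>z. real_of_ereal (f z)) x :> grad f x"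
proof -
  obtain D where D: "((\<lambda>z. real_of_ereal (f z)) has_derivative D) (at x)"
    using assms by (auto simp: differentiable_def)
  have "D = (\<lambda>h. h \<bullet> adjoint D 1)"
    using adjoint_works[OF has_derivative_linear[OF D]] by (simp add: fun_eq_iff)
  with D have g: "GDERIV (\<lambda>z. real_of_ereal (f z)) x :> adjoint D 1"
    unfolding gderiv_def by simp
  moreover have "d = adjoint D 1" if "GDERIV (\<lambda>z. real_of_ereal (f z)) x :> d" for d
    using has_derivative_unique[OF that[unfolded gderiv_def] g[unfolded gderiv_def]]
    by (metis vector_eq_ldot)
  ultimately show ?thesis
    unfolding grad_def by (rule theI)
qed

lemma continuous_hessian_on_imp_continuous_on_grad:
  "continuous_hessian_on U f \<Longrightarrow> continuous_on U (grad f)"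
  unfolding continuous_hessian_on_def
  by (meson continuous_at_imp_continuous_on has_derivative_continuous)

locale legendre_function =
  fixes f :: "'a::euclidean_space \<Rightarrow> ereal" and U :: "'a set"
  assumes Gamma0: "f \<in> Gamma0" and legendre: "legendre_type f"
  defines "U \<equiv> interior (edom f)"
begin

abbreviation F :: "'a \<Rightarrow> real" where "F z \<equiv> real_of_ereal (f z)"

lemma lsc: "lsc_fun f" and convex: "convex_fun f" and not_MInf: "f x \<noteq> - \<infinity>"
  using Gamma0 by (auto simp: Gamma0_def proper_fun_def)

lemma open_U: "open U" and convex_U: "convex U" and U_subset: "U \<subseteq> edom f"
  using convex_edom[OF convex] by (simp_all add: U_def interior_subset convex_interior)

lemma f_eq_F: "f x < \<infinity> \<Longrightarrow> f x = ereal (F x)"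
  using not_MInf[of x] by (cases "f x") auto

lemma f_eq_F_U: "x \<in> U \<Longrightarrow> f x = ereal (F x)"
  using U_subset by (intro f_eq_F) (auto simp: edom_def)

lemma GDERIV_F: "x \<in> U \<Longrightarrow> GDERIV F x :> grad f x"
  using legendre by (intro grad_GDERIV) (auto simp: legendre_type_def essentially_smooth_def U_def)

lemma continuous_on_F: "continuous_on U F"
  using GDERIV_F unfolding gderiv_def
  by (meson continuous_at_imp_continuous_on has_derivative_continuous)

text \<open>Convexity keeps \<open>F\<close> below its chord from \<open>y\<close> to
  \<open>x\<close>. If the directional derivative at \<open>y\<close> exceeded the slope of the
  chord, then \<open>h\<close>, which is \<open>F\<close> minus the linear part of the chord, would
  rise above \<open>h 0\<close> just to the right of 0.\<close>

lemma subgradient: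
  assumes y: "y \<in> U" and x: "f x < \<infinity>"
  shows "F y + grad f y \<bullet> (x - y) \<le> F x"
proof (rule ccontr)
  let ?m = "grad f y \<bullet> (x - y)"
  define h where "h t = F (y + t *\<^sub>R (x - y)) - t * (F x - F y)" for t
  assume "\<not> ?thesis"
  then have m: "0 < ?m - (F x - F y)" by simp
  have g: "(F has_derivative (\<lambda>h. h \<bullet> grad f y)) (at (y + 0 *\<^sub>R (x - y)))"
    using GDERIV_F[OF y] by (simp add: gderiv_def)
  have "((\<lambda>t. y + t *\<^sub>R (x - y)) has_derivative (\<lambda>t. t *\<^sub>R (x - y))) (at 0)"
    by (auto intro!: derivative_eq_intros)
  from has_derivative_compose[OF this g]
  have "((\<lambda>t. F (y + t *\<^sub>R (x - y))) has_derivative (\<lambda>t. (t *\<^sub>R (x - y)) \<bullet> grad f y)) (at 0)" .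
  moreover have "(\<lambda>t. (t *\<^sub>R (x - y)) \<bullet> grad f y) = (*) ?m"
    by (simp add: fun_eq_iff inner_commute)
  ultimately have "DERIV (\<lambda>t. F (y + t *\<^sub>R (x - y))) 0 :> ?m"
    by (simp add: has_field_derivative_def)
  then have "DERIV h 0 :> ?m - (F x - F y)"
    unfolding h_def by (auto intro!: derivative_eq_intros)
  from DERIV_pos_inc_right[OF this m] obtain d where
    d: "d > 0" "\<And>t. t > 0 \<Longrightarrow> t < d \<Longrightarrow> h 0 < h t" by auto
  \<comment> \<open>Below \<open>d\<close> the derivative forces \<open>h 0 < h t\<close>; up to 1
    the point stays on the chord.\<close>
  define t where "t = min (d / 2) 1"
  have t: "0 < t" "t < d" "t \<le> 1"
    using d(1) by (auto simp: t_def)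
  have "f (y + t *\<^sub>R (x - y)) \<le> ereal (F y + t * (F x - F y))"
    using t f_eq_F[OF x] f_eq_F_U[OF y] by (intro convex_funD[OF convex]) auto
  then have "F (y + t *\<^sub>R (x - y)) \<le> F y + t * (F x - F y)"
    using not_MInf[of "y + t *\<^sub>R (x - y)"] by (cases "f (y + t *\<^sub>R (x - y))") auto
  with d(2)[OF t(1,2)] show False
    by (simp add: h_def)
qed

section \<open>Values, positivity and strict convexity of the Bregman distance\<close>

lemma bregman_outside: "y \<notin> U \<Longrightarrow> bregman f x y = \<infinity>"
  by (simp add: bregman_def U_def)

lemma bregman_ereal:
  "y \<in> U \<Longrightarrow> f x < \<infinity> \<Longrightarrow> bregman f x y = ereal (F x - F y - grad f y \<bullet> (x - y))"
  using f_eq_F[of x] f_eq_F_U[of y] by (auto simp: bregman_def U_def) (metis ereal_minus(1))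

lemma bregman_ereal_U:
  "x \<in> U \<Longrightarrow> y \<in> U \<Longrightarrow> bregman f x y = ereal (F x - F y - grad f y \<bullet> (x - y))"
  using U_subset by (intro bregman_ereal) (auto simp: edom_def)

lemma bregman_infinite: "f x = \<infinity> \<Longrightarrow> bregman f x y = \<infinity>"
  by (cases "y \<in> U") (use f_eq_F_U in \<open>auto simp: bregman_def U_def\<close>)

lemma bregman_nonneg: "0 \<le> bregman f x y"
proof (cases "y \<in> U \<and> f x < \<infinity>")
  case True
  then show ?thesis
    using subgradient[of y x] by (simp add: bregman_ereal)
next
  case False
  then show ?thesis
    using bregman_outside bregman_infinite by force
qed

lemma bregman_not_MInf: "bregman f x y \<noteq> - \<infinity>"
  using bregman_nonneg[of x y] by auto

text \<open>The gradient is a subgradient at each point of \<open>U\<close>, so the convex set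
  \<open>U\<close> is among those covered by essential strict convexity.\<close>

lemma strictly_convex: "strictly_convex_fun_on U f"
proof -
  have "U \<subseteq> {x. subdifferential f x \<noteq> {}}"
  proof clarify
    fix x assume x: "x \<in> U" and "subdifferential f x = {}"
    have "f x + ereal (grad f x \<bullet> (z - x)) \<le> f z" for z
    proof (cases "f z < \<infinity>")
      case True
      then show ?thesis
        using subgradient[OF x True] f_eq_F[OF True] f_eq_F_U[OF x]
        by (metis ereal_less_eq(3) plus_ereal.simps(1))
    qed simp
    then have "grad f x \<in> subdifferential f x"
      by (simp add: subdifferential_def)
    with \<open>subdifferential f x = {}\<close> show False by simp
  qed
  then show ?thesis
    using legendre convex_U by (auto simp: legendre_type_def essentially_strictly_convex_def)
qed

text \<open>For fixed \<open>y\<close> the distance is \<open>f\<close> plus an affine function of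
  the first argument, so the strict convexity of \<open>f\<close> carries over.\<close>

lemma bregman_strictly_convex_left:
  assumes y: "y \<in> U"
  shows "strictly_convex_fun_on U (\<lambda>x. bregman f x y)"
  unfolding strictly_convex_fun_on_def
proof (intro ballI allI impI)
  fix a b and t :: real
  assume ab: "a \<in> U" "b \<in> U" and t: "a \<noteq> b \<and> 0 < t \<and> t < 1"
  define m where "m = (1 - t) *\<^sub>R a + t *\<^sub>R b"
  have m: "m \<in> U"
    unfolding m_def using ab t convex_U by (intro convexD) auto
  have "f m < ereal (1 - t) * f a + ereal t * f b"
    unfolding m_def using ab t strictly_convex by (auto simp: strictly_convex_fun_on_def)
  then have "F m < (1 - t) * F a + t * F b"
    using not_MInf[of m] f_eq_F_U[OF ab(1)] f_eq_F_U[OF ab(2)]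
    by (cases "f m"; cases "f a"; cases "f b") auto
  moreover have "grad f y \<bullet> (m - y)
      = (1 - t) * (grad f y \<bullet> (a - y)) + t * (grad f y \<bullet> (b - y))"
    by (simp add: m_def inner_diff_right inner_add_right algebra_simps)
  ultimately show "bregman f m y < ereal (1 - t) * bregman f a y + ereal t * bregman f b y"
    by (simp add: bregman_ereal_U m ab y algebra_simps)
qed

text \<open>The point \<open>x\<close> may lie on the boundary, while strict convexity is known on
  \<open>U\<close>. The midpoint \<open>m\<close> of \<open>x\<close> and \<open>y\<close> lies in
  \<open>U\<close> and its distance to \<open>y\<close> is still at most 0, by convexity. Strict
  convexity between \<open>y\<close> and \<open>m\<close> would then produce a negative
  distance.\<close>

lemma bregman_eq_0_iff:
  assumes y: "y \<in> U"
  shows "bregman f x y = 0 \<longleftrightarrow> x = y"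
proof
  assume 0: "bregman f x y = 0"
  show "x = y"
  proof (rule ccontr)
    assume "x \<noteq> y"
    have x: "f x < \<infinity>"
      using 0 bregman_infinite[of x y] by auto
    have Dx: "F x - F y - grad f y \<bullet> (x - y) = 0"
      using 0 bregman_ereal[OF y x] by simp
    define m where "m = x - (1/2) *\<^sub>R (x - y)"
    have "x \<in> closure (edom f)"
      using x closure_subset by (force simp: edom_def)
    then have m: "m \<in> U"
      using y convex_edom[OF convex] unfolding m_def U_def
      by (intro mem_interior_closure_convex_shrink) auto
    define n where "n = y + (1/2) *\<^sub>R (m - y)"
    have n': "n = (1 - 1/2) *\<^sub>R y + (1/2) *\<^sub>R m"
      by (simp add: n_def algebra_simps flip: scaleR_add_left)
    then have n: "n \<in> U"
      using convexD[OF convex_U y m, of "1 - 1/2" "1/2"] by simp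
    have "m \<noteq> y"
      using \<open>x \<noteq> y\<close> by (simp add: m_def algebra_simps)
    have mx: "m = y + (1/2) *\<^sub>R (x - y)"
      by (simp add: m_def algebra_simps flip: scaleR_add_left)
    have "f m \<le> ereal (F y + (1/2) * (F x - F y))"
      unfolding mx using f_eq_F[OF x] f_eq_F_U[OF y] by (intro convex_funD[OF convex]) auto
    then have "F m \<le> F y + (1/2) * (F x - F y)"
      using not_MInf[of m] by (cases "f m") auto
    moreover have "grad f y \<bullet> (m - y) = (1/2) * (grad f y \<bullet> (x - y))"
      by (simp add: mx)
    ultimately have "F m - F y - grad f y \<bullet> (m - y) \<le> 0"
      using Dx by argo
    then have "bregman f m y \<le> 0"
      by (simp add: bregman_ereal_U m y)
    moreover have "bregman f n y < ereal (1 - 1/2) * bregman f y y + ereal (1/2) * bregman f m y"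
      unfolding n' using \<open>m \<noteq> y\<close> y m
      by (intro bregman_strictly_convex_left[OF y, unfolded strictly_convex_fun_on_def, rule_format]) auto
    moreover have "bregman f y y = 0"
      by (simp add: bregman_ereal_U y)
    ultimately have "bregman f n y < 0"
      using bregman_nonneg[of m y] by (simp add: antisym)
    then show False
      using bregman_nonneg[of n y] by simp
  qed
qed (simp add: bregman_ereal_U y)

text \<open>The symmetrised Bregman distance bounds each of its two summands.\<close>

lemma bregman_le_grad_diff:
  assumes "x \<in> U" "y \<in> U"
  shows "F x - F y - grad f y \<bullet> (x - y) \<le> (grad f x - grad f y) \<bullet> (x - y)"
proof -
  have "F x + grad f x \<bullet> (y - x) \<le> F y"
    using assms U_subset by (intro subgradient) (auto simp: edom_def)
  then show ?thesis
    by (simp add: inner_diff_left inner_diff_right)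
qed

lemma bregman_le_norm:
  assumes "x \<in> U" "y \<in> U"
  shows "bregman f x y \<le> ereal (norm (grad f x - grad f y) * norm (x - y))"
  using order_trans[OF bregman_le_grad_diff[OF assms] norm_cauchy_schwarz] assms
  by (simp add: bregman_ereal_U)

text \<open>Testing the subgradient inequality at \<open>v\<close> against the point of a ball around \<open>x\<close> in the
  direction of \<open>grad f v\<close>.\<close>

lemma bregman_growth:
  assumes x: "x \<in> U"
  shows "\<exists>\<epsilon>>0. \<exists>C. \<forall>v\<in>U. \<epsilon> * norm (grad f v) - C \<le> F x - F v - grad f v \<bullet> (x - v)"
proof -
  obtain \<epsilon> where \<epsilon>: "\<epsilon> > 0" "cball x \<epsilon> \<subseteq> U"
    using open_U x open_contains_cball by blast
  have "bounded (F ` cball x \<epsilon>)"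
    using \<epsilon>(2) continuous_on_subset[OF continuous_on_F]
    by (intro compact_imp_bounded compact_continuous_image) auto
  then obtain K where "\<forall>z\<in>cball x \<epsilon>. \<bar>F z\<bar> \<le> K"
    by (auto simp: bounded_iff)
  then have K: "F z \<le> K" if "z \<in> cball x \<epsilon>" for z
    using that by (meson abs_le_D1)
  have "\<epsilon> * norm (grad f v) - (K - F x) \<le> F x - F v - grad f v \<bullet> (x - v)" if v: "v \<in> U" for v
  proof -
    define z where "z = x + \<epsilon> *\<^sub>R sgn (grad f v)"
    have z: "z \<in> cball x \<epsilon>"
      using \<epsilon>(1) by (simp add: z_def dist_norm norm_sgn)
    \<comment> \<open>For a zero gradient \<open>sgn\<close> is 0, and the identity reads
      \<open>0 = 0\<close>.\<close>
    have "grad f v \<bullet> sgn (grad f v) = norm (grad f v)"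
      by (cases "grad f v = 0")
        (simp_all add: sgn_div_norm power2_norm_eq_inner[symmetric] power2_eq_square)
    then have "grad f v \<bullet> (z - v) = grad f v \<bullet> (x - v) + \<epsilon> * norm (grad f v)"
      by (simp add: z_def inner_add_right inner_diff_right)
    moreover have "F v + grad f v \<bullet> (z - v) \<le> F z"
      using v z \<epsilon>(2) U_subset by (intro subgradient) (auto simp: edom_def)
    ultimately show ?thesis
      using K[OF z] by linarith
  qed
  with \<epsilon>(1) show ?thesis by blast
qed

section \<open>Lower semicontinuity and behaviour at the boundary\<close>

lemma norm_grad_at_top:
  assumes "\<And>n. s n \<in> U" "s \<longlonglongrightarrow> z" "z \<in> frontier U"
  shows "filterlim (\<lambda>n. norm (grad f (s n))) at_top sequentially"
  using assms legendre unfolding legendre_type_def essentially_smooth_def U_def by blast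

lemma lsc_bregman_left:
  assumes y: "y \<in> U"
  shows "lsc_fun (\<lambda>x. bregman f x y)"
proof -
  have "bregman f x y = f x + ereal (- F y - grad f y \<bullet> (x - y))" for x
    using y not_MInf[of x] f_eq_F_U[OF y] unfolding bregman_def U_def[symmetric]
    by (cases "f x"; cases "f y") auto
  moreover have "lsc_fun (\<lambda>x. f x + ereal (- F y - grad f y \<bullet> (x - y)))"
    by (intro lsc_fun_add lsc lsc_fun_ereal continuous_intros) (auto simp: not_MInf)
  ultimately show ?thesis by simp
qed

text \<open>Inside \<open>U\<close> this is continuity of \<open>F\<close> and of the gradient.
  Outside \<open>U\<close> the value is \<open>\<infinity>\<close>, and a sublevel set accumulating
  there would contain a sequence tending to the frontier: gradients blow up along it, which
  \<open>bregman_growth\<close> forbids at bounded distance.\<close>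

lemma lsc_bregman_right:
  assumes cont: "continuous_on U (grad f)" and x: "x \<in> U"
  shows "lsc_fun (\<lambda>y. bregman f x y)"
  unfolding lsc_fun_iff
proof (intro allI impI)
  fix v c assume c: "c < bregman f x v"
  show "\<forall>\<^sub>F z in at v. c < bregman f x z"
  proof (cases "v \<in> U")
    case True
    have "continuous (at v) (\<lambda>z. F x - F z - grad f z \<bullet> (x - z))"
      using continuous_on_F cont open_U True
      by (intro continuous_intros) (auto simp: continuous_on_eq_continuous_at)
    then have "((\<lambda>z. ereal (F x - F z - grad f z \<bullet> (x - z)))
        \<longlongrightarrow> ereal (F x - F v - grad f v \<bullet> (x - v))) (at v)"
      unfolding isCont_def by (rule tendsto_ereal)
    then have "\<forall>\<^sub>F z in at v. c < ereal (F x - F z - grad f z \<bullet> (x - z))"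
      using c True x by (intro order_tendstoD(1)) (auto simp: bregman_ereal_U)
    moreover have "\<forall>\<^sub>F z in at v. z \<in> U"
      using open_U True by (rule eventually_at_in_open')
    ultimately show ?thesis
      by eventually_elim (simp add: bregman_ereal_U x)
  next
    case False
    show ?thesis
    proof (rule ccontr)
      assume neg: "\<not> ?thesis"
      define S where "S = {z. bregman f x z \<le> c}"
      have "c < \<infinity>"
        using c by auto
      then obtain r where r: "c \<le> ereal r"
        by (cases c) auto
      have SU: "S \<subseteq> U"
        using bregman_outside \<open>c < \<infinity>\<close> by (force simp: S_def)
      have "v islimpt S"
        using neg by (simp add: islimpt_iff_eventually S_def not_le)
      then have "v \<in> closure S"
        by (simp add: closure_def)
      then obtain s where s: "\<And>n. s n \<in> S" "s \<longlonglongrightarrow> v"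
        by (auto simp: closure_sequential)
      have "v \<in> closure U"
        using \<open>v \<in> closure S\<close> closure_mono[OF SU] by blast
      then have "v \<in> frontier U"
        using False open_U by (simp add: frontier_def interior_open)
      then have lim: "filterlim (\<lambda>n. norm (grad f (s n))) at_top sequentially"
        using s SU by (intro norm_grad_at_top) auto
      obtain \<epsilon> C where \<epsilon>: "\<epsilon> > 0"
        "\<And>v. v \<in> U \<Longrightarrow> \<epsilon> * norm (grad f v) - C \<le> F x - F v - grad f v \<bullet> (x - v)"
        using bregman_growth[OF x] by blast
      have bound: "norm (grad f (s n)) \<le> (r + C) / \<epsilon>" for n
      proof -
        have sn: "s n \<in> U" using s(1) SU by blast
        have "bregman f x (s n) \<le> ereal r"
          using s(1)[of n] r by (auto simp: S_def intro: order_trans)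
        then have "\<epsilon> * norm (grad f (s n)) \<le> r + C"
          using \<epsilon>(2)[OF sn] sn x by (simp add: bregman_ereal_U)
        then show ?thesis
          using \<epsilon>(1) by (simp add: field_simps)
      qed
      obtain n where "(r + C) / \<epsilon> < norm (grad f (s n))"
        using lim unfolding filterlim_at_top_dense by (meson eventually_happens sequentially_bot)
      with bound[of n] show False by simp
    qed
  qed
qed

text \<open>At a boundary point \<open>p\<close> the slope of \<open>f\<close> towards a point \<open>u\<close> of \<open>U\<close> is \<open>- \<infinity>\<close>, so moving
  from \<open>p\<close> towards \<open>u\<close> decreases the objective.\<close>

lemma left_argmin_in_U:
  fixes \<theta> :: "'a \<Rightarrow> ereal"
  assumes \<theta>: "convex_fun \<theta>" "\<And>x. \<theta> x \<noteq> - \<infinity>"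
    and u: "u \<in> U" "\<theta> u < \<infinity>"
    and c: "0 < c"
    and y: "y \<in> U"
    and p: "p \<in> argmin (\<lambda>x. \<theta> x + ereal c * bregman f x y)"
  shows "p \<in> U"
proof (rule ccontr)
  assume "p \<notin> U"
  obtain b where b: "\<theta> u = ereal b"
    using u(2) \<theta>(2)[of u] by (cases "\<theta> u") auto
  have "\<theta> p + ereal c * bregman f p y \<le> \<theta> u + ereal c * bregman f u y"
    using p by (simp add: in_argmin_iff)
  also have "\<dots> < \<infinity>"
    by (simp add: b bregman_ereal_U u y)
  finally have fin: "\<theta> p + ereal c * bregman f p y < \<infinity>" .
  obtain a where a: "\<theta> p = ereal a"
    using fin \<theta>(2)[of p] by (cases "\<theta> p") auto
  have fp: "f p < \<infinity>"
    using fin bregman_infinite[of p y] c a by (cases "f p") auto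
  have pc: "p \<in> closure (edom f)"
    using fp closure_subset by (force simp: edom_def)
  \<comment> \<open>A convex set and its nonempty interior have the same closure, so a point of
    finite \<open>f\<close> outside \<open>U\<close> lies on the frontier.\<close>
  have "closure U = closure (edom f)"
    unfolding U_def using u(1) convex_edom[OF convex]
    by (intro convex_closure_interior) (auto simp: U_def)
  with pc \<open>p \<notin> U\<close> have pf: "p \<in> frontier U"
    using open_U by (simp add: frontier_def interior_open)
  define w where "w = u - p"
  \<comment> \<open>The shift by two keeps \<open>t n\<close> strictly below 1 already at
    \<open>n = 0\<close>, so that \<open>1 - t n\<close> is positive.\<close>
  define t where "t n = inverse (real (Suc (Suc n)))" for n
  define s where "s n = p + t n *\<^sub>R w" for n
  have t: "0 < t n" "t n < 1" for n
    by (auto simp: t_def field_simps)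
  have sU: "s n \<in> U" for n
  proof -
    have "p - t n *\<^sub>R (p - u) \<in> U"
      using t[of n] pc u(1) convex_edom[OF convex] unfolding U_def
      by (intro mem_interior_closure_convex_shrink) auto
    then show ?thesis
      by (simp add: s_def w_def algebra_simps)
  qed
  have "t \<longlonglongrightarrow> 0"
    unfolding t_def by (intro LIMSEQ_Suc LIMSEQ_inverse_real_of_nat)
  then have "s \<longlonglongrightarrow> p + 0 *\<^sub>R w"
    unfolding s_def by (intro tendsto_intros)
  then have lim: "filterlim (\<lambda>n. norm (grad f (s n))) at_top sequentially"
    using sU pf by (intro norm_grad_at_top) auto
  obtain \<epsilon> C where \<epsilon>: "\<epsilon> > 0"
    "\<And>v. v \<in> U \<Longrightarrow> \<epsilon> * norm (grad f v) - C \<le> F u - F v - grad f v \<bullet> (u - v)"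
    using bregman_growth[OF u(1)] by blast
  \<comment> \<open>Chosen so that
    \<open>grad f u \<bullet> w - grad f (s n) \<bullet> w > M\<close> forces
    \<open>grad f y \<bullet> w - grad f (s n) \<bullet> w\<close> above
    \<open>\<bar>b - a\<bar> / c\<close>, contrary to the bound that optimality of \<open>p\<close>
    yields.\<close>
  define M where "M = \<bar>b - a\<bar> / c + \<bar>grad f u \<bullet> w\<bar> + \<bar>grad f y \<bullet> w\<bar>"
  obtain n where "(M + C) / \<epsilon> < norm (grad f (s n))"
    using lim unfolding filterlim_at_top_dense by (meson eventually_happens sequentially_bot)
  then have "M < \<epsilon> * norm (grad f (s n)) - C"
    using \<epsilon>(1) by (simp add: field_simps)
  also have "\<dots> \<le> F u - F (s n) - grad f (s n) \<bullet> (u - s n)"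
    using \<epsilon>(2) sU by blast
  also have "\<dots> \<le> (grad f u - grad f (s n)) \<bullet> (u - s n)"
    using u(1) sU by (rule bregman_le_grad_diff)
  also have "u - s n = (1 - t n) *\<^sub>R w"
    by (simp add: s_def w_def algebra_simps)
  finally have M: "M < (1 - t n) * ((grad f u - grad f (s n)) \<bullet> w)"
    by simp
  have "0 \<le> M"
    using c by (simp add: M_def)
  with M have "0 < (grad f u - grad f (s n)) \<bullet> w"
    using t[of n] by (metis diff_gt_0_iff_gt le_less_trans zero_less_mult_pos)
  then have "(1 - t n) * ((grad f u - grad f (s n)) \<bullet> w) \<le> (grad f u - grad f (s n)) \<bullet> w"
    using t[of n] by (simp add: mult_le_cancel_right1)
  with M have M': "M < grad f u \<bullet> w - grad f (s n) \<bullet> w"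
    by (simp add: inner_diff_left)
  \<comment> \<open>Now \<open>p\<close> competes with \<open>s n\<close>: convexity bounds the
    change of \<open>\<theta>\<close> by \<open>t n * (b - a)\<close>, and optimality of
    \<open>p\<close> then limits the drop of \<open>F\<close>.\<close>
  have "\<theta> (s n) \<le> ereal (a + t n * (b - a))"
    unfolding s_def w_def using t[of n] a b by (intro convex_funD[OF \<theta>(1)]) auto
  then have "\<theta> (s n) + ereal c * bregman f (s n) y
      \<le> ereal (a + t n * (b - a)) + ereal c * bregman f (s n) y"
    by (rule add_right_mono)
  moreover have "\<theta> p + ereal c * bregman f p y \<le> \<theta> (s n) + ereal c * bregman f (s n) y"
    using p by (simp add: in_argmin_iff)
  ultimately have "\<theta> p + ereal c * bregman f p y
      \<le> ereal (a + t n * (b - a)) + ereal c * bregman f (s n) y"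
    by (rule order_trans[rotated])
  then have "c * (F p - F y - grad f y \<bullet> (p - y))
      \<le> t n * (b - a) + c * (F (s n) - F y - grad f y \<bullet> (s n - y))"
    by (simp add: a bregman_ereal[OF y fp] bregman_ereal_U y sU)
  moreover have "grad f y \<bullet> (s n - y) = grad f y \<bullet> (p - y) + t n * (grad f y \<bullet> w)"
    by (simp add: s_def inner_add_right inner_diff_right)
  ultimately have 1: "c * (F p - F (s n) + t n * (grad f y \<bullet> w)) \<le> t n * (b - a)"
    by (simp add: algebra_simps)
  \<comment> \<open>The subgradient inequality at \<open>s n\<close>, tested at \<open>p\<close>,
    bounds the drop from below. After division by \<open>t n\<close> it caps
    \<open>- grad f (s n) \<bullet> w\<close>, against \<open>M'\<close>.\<close>
  have "F (s n) + grad f (s n) \<bullet> (p - s n) \<le> F p"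
    using sU fp by (rule subgradient)
  then have "- (t n * (grad f (s n) \<bullet> w)) \<le> F p - F (s n)"
    by (simp add: s_def)
  then have "t n * (grad f y \<bullet> w - grad f (s n) \<bullet> w) \<le> F p - F (s n) + t n * (grad f y \<bullet> w)"
    by (simp add: algebra_simps)
  then have "c * (t n * (grad f y \<bullet> w - grad f (s n) \<bullet> w)) \<le> t n * (b - a)"
    using 1 c by (meson mult_left_mono less_imp_le order_trans)
  then have "t n * (c * (grad f y \<bullet> w - grad f (s n) \<bullet> w)) \<le> t n * (b - a)"
    by (simp add: ac_simps)
  then have "c * (grad f y \<bullet> w - grad f (s n) \<bullet> w) \<le> b - a"
    using t[of n] by simp
  then have "grad f y \<bullet> w - grad f (s n) \<bullet> w \<le> (b - a) / c"
    using c by (simp add: field_simps)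
  also have "\<dots> \<le> \<bar>b - a\<bar> / c"
    using c by (intro divide_right_mono) auto
  finally show False
    using M' by (simp add: M_def)
qed

section \<open>The two characterisations\<close>

lemma grad_diff_norm_tendsto_0:
  assumes "continuous_on U (grad f)" "a \<in> U"
  shows "((\<lambda>z. norm (grad f z - grad f a)) \<longlongrightarrow> 0) (at a)"
proof -
  have "(grad f \<longlongrightarrow> grad f a) (at a)"
    using assms open_U by (simp add: continuous_on_eq_continuous_at isCont_def)
  then show ?thesis
    by (simp add: LIM_zero tendsto_norm_zero)
qed

lemma left_prox_characterisation:
  fixes \<theta> :: "'a \<Rightarrow> ereal"
  assumes cont: "continuous_on U (grad f)"
    and \<theta>: "\<theta> \<in> Gamma0" "U \<inter> edom \<theta> \<noteq> {}"
    and \<gamma>: "0 < \<gamma>"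
    and coe: "\<forall>v\<in>U. coercive (\<lambda>u. \<theta> u + ereal (1 / \<gamma>) * bregman f u v)"
    and y: "y \<in> U"
  shows "y \<in> argmin \<theta> \<longleftrightarrow> y \<in> Fix_on U (left_prox f \<theta> \<gamma>)"
    and "y \<in> argmin \<theta> \<longleftrightarrow> y \<in> argmin (left_env f \<theta> \<gamma>)"
    and "y \<in> argmin \<theta> \<longleftrightarrow> \<theta> (left_prox f \<theta> \<gamma> y) = \<theta> y"
    and "y \<in> argmin \<theta> \<longleftrightarrow> left_env f \<theta> \<gamma> y = \<theta> y"
proof -
  have \<theta>': "convex_fun \<theta>" "lsc_fun \<theta>" "\<And>x. \<theta> x \<noteq> - \<infinity>"
    using \<theta>(1) by (auto simp: Gamma0_def proper_fun_def)
  have c: "0 < 1 / \<gamma>" using \<gamma> by simp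
  obtain u where u: "u \<in> U" "\<theta> u < \<infinity>"
    using \<theta>(2) by (auto simp: edom_def)
  have fin: "\<theta> u + ereal (1 / \<gamma>) * bregman f u a < \<infinity>" if "a \<in> U" for a
    using u that \<theta>'(3)[of u] by (cases "\<theta> u") (auto simp: bregman_ereal_U)
  note finite = argmin_perturbed_finite[where \<theta> = \<theta> and u = u and \<phi> = "\<lambda>b. bregman f b a" for a,
      OF \<theta>'(3) bregman_nonneg c fin]
  have prox: "left_prox f \<theta> \<gamma> a = (THE b. b \<in> argmin (\<lambda>b. \<theta> b + ereal (1 / \<gamma>) * bregman f b a))" for a
    by (simp add: left_prox_def argmin_scale[OF \<gamma>])
  have env: "left_env f \<theta> \<gamma> a = (INF b. \<theta> b + ereal (1 / \<gamma>) * bregman f b a)" for a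
    by (simp add: left_env_def)
  have mem: "p \<in> U" if "a \<in> U" "p \<in> argmin (\<lambda>b. \<theta> b + ereal (1 / \<gamma>) * bregman f b a)" for a p
    using \<theta>'(1,3) u c that by (rule left_argmin_in_U)
  have ex: "\<exists>b. b \<in> argmin (\<lambda>b. \<theta> b + ereal (1 / \<gamma>) * bregman f b a)" if "a \<in> U" for a
  proof (rule lsc_coercive_argmin_nonempty[where z = u])
    show "lsc_fun (\<lambda>b. \<theta> b + ereal (1 / \<gamma>) * bregman f b a)"
      using \<theta>'(2,3) c lsc_bregman_left[OF that]
      by (intro lsc_fun_add lsc_fun_cmult) (auto simp: bregman_not_MInf)
  qed (use coe fin that in auto)
  have uniq: "p = q" if a: "a \<in> U"
    and p: "p \<in> argmin (\<lambda>b. \<theta> b + ereal (1 / \<gamma>) * bregman f b a)"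
    and q: "q \<in> argmin (\<lambda>b. \<theta> b + ereal (1 / \<gamma>) * bregman f b a)" for a p q
    using \<theta>'(1,3) bregman_strictly_convex_left[OF a] bregman_not_MInf c
      mem[OF a p] p mem[OF a q] q finite(1)[OF a p]
    by (rule argmin_add_strictly_convex_unique)
  have self: "a \<in> argmin \<theta>"
    if a: "a \<in> U" and p: "a \<in> argmin (\<lambda>b. \<theta> b + ereal (1 / \<gamma>) * bregman f b a)" for a
  proof (rule argmin_of_argmin_perturbed[OF \<theta>'(1,3) c p finite(2)[OF a p]])
    have "\<forall>\<^sub>F z in at a. z \<in> U"
      using open_U a by (rule eventually_at_in_open')
    \<comment> \<open>The vanishing factor \<open>k z\<close> is
      \<open>norm (grad f z - grad f a)\<close>.\<close>
    then show "\<forall>\<^sub>F z in at a. bregman f z a \<le> ereal (norm (grad f z - grad f a) * norm (z - a))"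
      by eventually_elim (use bregman_le_norm a in blast)
  qed (use a grad_diff_norm_tendsto_0[OF cont a] in \<open>auto simp: bregman_eq_0_iff\<close>)
  have zero: "bregman f b a = 0 \<longleftrightarrow> a = b" if "a \<in> U" for a b
    using that by (auto simp: bregman_eq_0_iff)
  have fin': "\<exists>b. \<theta> b + ereal (1 / \<gamma>) * bregman f b a < \<infinity>" if "a \<in> U" for a
    using fin[OF that] by blast
  \<comment> \<open>The arguments are swapped because the left problem varies the first argument of
    the Bregman distance.\<close>
  note * = prox_env_equivalences[of \<theta> "1 / \<gamma>" "\<lambda>a b. bregman f b a" U y,
      OF \<theta>'(3) c bregman_nonneg zero fin' ex uniq mem self y, folded prox env]
  show "y \<in> argmin \<theta> \<longleftrightarrow> y \<in> Fix_on U (left_prox f \<theta> \<gamma>)"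
    by (rule *(1))
  show "y \<in> argmin \<theta> \<longleftrightarrow> y \<in> argmin (left_env f \<theta> \<gamma>)"
    by (rule *(2))
  show "y \<in> argmin \<theta> \<longleftrightarrow> \<theta> (left_prox f \<theta> \<gamma> y) = \<theta> y"
    by (rule *(3))
  show "y \<in> argmin \<theta> \<longleftrightarrow> left_env f \<theta> \<gamma> y = \<theta> y"
    by (rule *(4))
qed

lemma right_prox_characterisation:
  fixes \<theta> :: "'a \<Rightarrow> ereal"
  assumes cont: "continuous_on U (grad f)"
    and sc: "\<forall>u\<in>U. strictly_convex_fun_on U (\<lambda>v. bregman f u v)"
    and \<theta>: "\<theta> \<in> Gamma0" "U \<inter> edom \<theta> \<noteq> {}"
    and \<gamma>: "0 < \<gamma>"
    and coe: "\<forall>u\<in>U. coercive (\<lambda>v. \<theta> v + ereal (1 / \<gamma>) * bregman f u v)"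
    and x: "x \<in> U"
  shows "x \<in> argmin \<theta> \<longleftrightarrow> x \<in> Fix_on U (right_prox f \<theta> \<gamma>)"
    and "x \<in> argmin \<theta> \<longleftrightarrow> x \<in> argmin (right_env f \<theta> \<gamma>)"
    and "x \<in> argmin \<theta> \<longleftrightarrow> \<theta> (right_prox f \<theta> \<gamma> x) = \<theta> x"
    and "x \<in> argmin \<theta> \<longleftrightarrow> right_env f \<theta> \<gamma> x = \<theta> x"
proof -
  have \<theta>': "convex_fun \<theta>" "lsc_fun \<theta>" "\<And>x. \<theta> x \<noteq> - \<infinity>"
    using \<theta>(1) by (auto simp: Gamma0_def proper_fun_def)
  have c: "0 < 1 / \<gamma>" using \<gamma> by simp
  obtain u where u: "u \<in> U" "\<theta> u < \<infinity>"
    using \<theta>(2) by (auto simp: edom_def)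
  have fin: "\<theta> u + ereal (1 / \<gamma>) * bregman f a u < \<infinity>" if "a \<in> U" for a
    using u that \<theta>'(3)[of u] by (cases "\<theta> u") (auto simp: bregman_ereal_U)
  note finite = argmin_perturbed_finite[where \<theta> = \<theta> and u = u and \<phi> = "bregman f a" for a,
      OF \<theta>'(3) bregman_nonneg c fin]
  have prox: "right_prox f \<theta> \<gamma> a = (THE b. b \<in> argmin (\<lambda>b. \<theta> b + ereal (1 / \<gamma>) * bregman f a b))" for a
    by (simp add: right_prox_def argmin_scale[OF \<gamma>])
  have env: "right_env f \<theta> \<gamma> a = (INF b. \<theta> b + ereal (1 / \<gamma>) * bregman f a b)" for a
    by (simp add: right_env_def)
  have mem: "p \<in> U"
    if a: "a \<in> U" and p: "p \<in> argmin (\<lambda>b. \<theta> b + ereal (1 / \<gamma>) * bregman f a b)" for a p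
    \<comment> \<open>Here the variable is the second argument, where the distance is
      \<open>\<infinity>\<close> off \<open>U\<close>; finiteness alone gives membership.\<close>
    using finite(3)[OF a p] bregman_outside[of p a] by auto
  have ex: "\<exists>b. b \<in> argmin (\<lambda>b. \<theta> b + ereal (1 / \<gamma>) * bregman f a b)" if "a \<in> U" for a
  proof (rule lsc_coercive_argmin_nonempty[where z = u])
    show "lsc_fun (\<lambda>b. \<theta> b + ereal (1 / \<gamma>) * bregman f a b)"
      using \<theta>'(2,3) c lsc_bregman_right[OF cont that]
      by (intro lsc_fun_add lsc_fun_cmult) (auto simp: bregman_not_MInf)
  qed (use coe fin that in auto)
  have uniq: "p = q" if a: "a \<in> U"
    and p: "p \<in> argmin (\<lambda>b. \<theta> b + ereal (1 / \<gamma>) * bregman f a b)"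
    and q: "q \<in> argmin (\<lambda>b. \<theta> b + ereal (1 / \<gamma>) * bregman f a b)" for a p q
    using \<theta>'(1,3) sc[rule_format, OF a] bregman_not_MInf c
      mem[OF a p] p mem[OF a q] q finite(1)[OF a p]
    by (rule argmin_add_strictly_convex_unique)
  have self: "a \<in> argmin \<theta>"
    if a: "a \<in> U" and p: "a \<in> argmin (\<lambda>b. \<theta> b + ereal (1 / \<gamma>) * bregman f a b)" for a
  proof (rule argmin_of_argmin_perturbed[OF \<theta>'(1,3) c p finite(2)[OF a p]])
    have "\<forall>\<^sub>F z in at a. z \<in> U"
      using open_U a by (rule eventually_at_in_open')
    then show "\<forall>\<^sub>F z in at a. bregman f a z \<le> ereal (norm (grad f z - grad f a) * norm (z - a))"
      by eventually_elim (use bregman_le_norm[OF a] in \<open>simp add: norm_minus_commute\<close>)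
  qed (use a grad_diff_norm_tendsto_0[OF cont a] in \<open>auto simp: bregman_eq_0_iff\<close>)
  have zero: "bregman f a b = 0 \<longleftrightarrow> a = b" if "a \<in> U" for a b
    using that bregman_outside[of b a] by (cases "b \<in> U") (auto simp: bregman_eq_0_iff)
  have fin': "\<exists>b. \<theta> b + ereal (1 / \<gamma>) * bregman f a b < \<infinity>" if "a \<in> U" for a
    using fin[OF that] by blast
  note * = prox_env_equivalences[of \<theta> "1 / \<gamma>" "bregman f" U x,
      OF \<theta>'(3) c bregman_nonneg zero fin' ex uniq mem self x, folded prox env]
  show "x \<in> argmin \<theta> \<longleftrightarrow> x \<in> Fix_on U (right_prox f \<theta> \<gamma>)"
    by (rule *(1))
  show "x \<in> argmin \<theta> \<longleftrightarrow> x \<in> argmin (right_env f \<theta> \<gamma>)"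
    by (rule *(2))
  show "x \<in> argmin \<theta> \<longleftrightarrow> \<theta> (right_prox f \<theta> \<gamma> x) = \<theta> x"
    by (rule *(3))
  show "x \<in> argmin \<theta> \<longleftrightarrow> right_env f \<theta> \<gamma> x = \<theta> x"
    by (rule *(4))
qed

text \<open>Off \<open>U\<close> the left envelope is identically \<open>\<infinity>\<close>, while
  at a point of \<open>U\<close> in the domain of \<open>\<theta>\<close> it is finite or
  \<open>- \<infinity>\<close>. The right envelope can be finite outside \<open>U\<close>, whence
  the intersection with \<open>U\<close> in its set identity.\<close>

lemma argmin_left_env_subset:
  fixes \<theta> :: "'a \<Rightarrow> ereal"
  assumes \<theta>: "\<And>x. \<theta> x \<noteq> - \<infinity>" "U \<inter> edom \<theta> \<noteq> {}" and \<gamma>: "0 < \<gamma>"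
  shows "argmin (left_env f \<theta> \<gamma>) \<subseteq> U"
proof
  fix y assume y: "y \<in> argmin (left_env f \<theta> \<gamma>)"
  obtain u where u: "u \<in> U" "\<theta> u < \<infinity>"
    using \<theta>(2) by (auto simp: edom_def)
  have "left_env f \<theta> \<gamma> y \<le> left_env f \<theta> \<gamma> u"
    using y by (simp add: in_argmin_iff)
  also have "\<dots> \<le> \<theta> u + ereal (1 / \<gamma>) * bregman f u u"
    unfolding left_env_def by (rule INF_lower) simp
  also have "\<dots> < \<infinity>"
    using u by (simp add: bregman_ereal_U)
  finally have "left_env f \<theta> \<gamma> y < \<infinity>" .
  then obtain x where "\<theta> x + ereal (1 / \<gamma>) * bregman f x y < \<infinity>"
    unfolding left_env_def INF_less_iff by blast
  then show "y \<in> U"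
    using \<gamma> bregman_outside[of y x] by (cases "y \<in> U") auto
qed

end

theorem theorem2p20:
  fixes f \<theta> :: "real ^ 'n \<Rightarrow> ereal" and \<gamma> :: real and U :: "(real ^ 'n) set" and x y :: "real ^ 'n"
  assumes f: "f \<in> Gamma0" "legendre_type f"
    and U: "U = interior (edom f)"
    and A1: "continuous_hessian_on U f"
    and A2: "convex_fun (\<lambda>(u, v). bregman f u v)"
    and A3: "\<forall>u\<in>U. strictly_convex_fun_on U (\<lambda>v. bregman f u v)"
    and A4: "\<forall>u\<in>U. coercive (\<lambda>v. bregman f u v)"
    and \<theta>: "\<theta> \<in> Gamma0" "U \<inter> edom \<theta> \<noteq> {}"
    and \<gamma>: "0 < \<gamma>"
    and xy: "x \<in> U" "y \<in> U"
  shows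
    "((\<forall>v\<in>U. coercive (\<lambda>u. \<theta> u + ereal (1 / \<gamma>) * bregman f u v)) \<longrightarrow>
       ((y \<in> argmin \<theta> \<longleftrightarrow> y \<in> Fix_on U (left_prox f \<theta> \<gamma>)) \<and>
        (y \<in> argmin \<theta> \<longleftrightarrow> y \<in> argmin (left_env f \<theta> \<gamma>)) \<and>
        (y \<in> argmin \<theta> \<longleftrightarrow> \<theta> (left_prox f \<theta> \<gamma> y) = \<theta> y) \<and>
        (y \<in> argmin \<theta> \<longleftrightarrow> left_env f \<theta> \<gamma> y = \<theta> y)) \<and>
       U \<inter> argmin \<theta> = Fix_on U (left_prox f \<theta> \<gamma>) \<and>
       Fix_on U (left_prox f \<theta> \<gamma>) = argmin (left_env f \<theta> \<gamma>)) \<and>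
     ((\<forall>u\<in>U. coercive (\<lambda>v. \<theta> v + ereal (1 / \<gamma>) * bregman f u v)) \<longrightarrow>
       ((x \<in> argmin \<theta> \<longleftrightarrow> x \<in> Fix_on U (right_prox f \<theta> \<gamma>)) \<and>
        (x \<in> argmin \<theta> \<longleftrightarrow> x \<in> argmin (right_env f \<theta> \<gamma>)) \<and>
        (x \<in> argmin \<theta> \<longleftrightarrow> \<theta> (right_prox f \<theta> \<gamma> x) = \<theta> x) \<and>
        (x \<in> argmin \<theta> \<longleftrightarrow> right_env f \<theta> \<gamma> x = \<theta> x)) \<and>
       U \<inter> argmin \<theta> = Fix_on U (right_prox f \<theta> \<gamma>) \<and>
       Fix_on U (right_prox f \<theta> \<gamma>) = U \<inter> argmin (right_env f \<theta> \<gamma>))"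
proof -
  interpret legendre_function f U
    using f by unfold_locales (simp_all add: U)
  note cont = continuous_hessian_on_imp_continuous_on_grad[OF A1]
  have Fix_subset: "Fix_on U T \<subseteq> U" for T
    by (auto simp: Fix_on_def)
  show ?thesis
  \<comment> \<open>Instantiating \<open>conjI\<close> splits only the outer conjunction, leaving
    one goal per side.\<close>
  proof (intro conjI[of "_ \<longrightarrow> _" "_ \<longrightarrow> _"] impI)
    assume coe: "\<forall>v\<in>U. coercive (\<lambda>u. \<theta> u + ereal (1 / \<gamma>) * bregman f u v)"
    \<comment> \<open>The point of \<open>U\<close> is left open: the set identities need every
      point, the listed equivalences only \<open>y\<close>.\<close>
    note left = left_prox_characterisation[OF cont \<theta> \<gamma> coe]
    have "\<And>x. \<theta> x \<noteq> - \<infinity>"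
      using \<theta>(1) by (simp add: Gamma0_def proper_fun_def)
    then have "argmin (left_env f \<theta> \<gamma>) \<subseteq> U"
      using \<theta>(2) \<gamma> by (rule argmin_left_env_subset)
    then have "U \<inter> argmin \<theta> = Fix_on U (left_prox f \<theta> \<gamma>)"
      "Fix_on U (left_prox f \<theta> \<gamma>) = argmin (left_env f \<theta> \<gamma>)"
      using left(1,2) Fix_subset by blast+
    with left[OF xy(2)] show "((y \<in> argmin \<theta> \<longleftrightarrow> y \<in> Fix_on U (left_prox f \<theta> \<gamma>)) \<and>
        (y \<in> argmin \<theta> \<longleftrightarrow> y \<in> argmin (left_env f \<theta> \<gamma>)) \<and>
        (y \<in> argmin \<theta> \<longleftrightarrow> \<theta> (left_prox f \<theta> \<gamma> y) = \<theta> y) \<and>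
        (y \<in> argmin \<theta> \<longleftrightarrow> left_env f \<theta> \<gamma> y = \<theta> y)) \<and>
       U \<inter> argmin \<theta> = Fix_on U (left_prox f \<theta> \<gamma>) \<and>
       Fix_on U (left_prox f \<theta> \<gamma>) = argmin (left_env f \<theta> \<gamma>)"
      by (intro conjI)
  next
    assume coe: "\<forall>u\<in>U. coercive (\<lambda>v. \<theta> v + ereal (1 / \<gamma>) * bregman f u v)"
    note right = right_prox_characterisation[OF cont A3 \<theta> \<gamma> coe]
    have "U \<inter> argmin \<theta> = Fix_on U (right_prox f \<theta> \<gamma>)"
      "Fix_on U (right_prox f \<theta> \<gamma>) = U \<inter> argmin (right_env f \<theta> \<gamma>)"
      using right(1,2) Fix_subset by blast+
    with right[OF xy(1)] show "((x \<in> argmin \<theta> \<longleftrightarrow> x \<in> Fix_on U (right_prox f \<theta> \<gamma>)) \<and>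
        (x \<in> argmin \<theta> \<longleftrightarrow> x \<in> argmin (right_env f \<theta> \<gamma>)) \<and>
        (x \<in> argmin \<theta> \<longleftrightarrow> \<theta> (right_prox f \<theta> \<gamma> x) = \<theta> x) \<and>
        (x \<in> argmin \<theta> \<longleftrightarrow> right_env f \<theta> \<gamma> x = \<theta> x)) \<and>
       U \<inter> argmin \<theta> = Fix_on U (right_prox f \<theta> \<gamma>) \<and>
       Fix_on U (right_prox f \<theta> \<gamma>) = U \<inter> argmin (right_env f \<theta> \<gamma>)"
      by (intro conjI)
  qed
qed

end
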